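(* Let $n\geqslant 2$ and $r$ be two fixed positive integers and let $d$ be an integer tending to infinity. Then $$m\left(K_n^d, r\right)=\big(1+o(1)\big)\frac{d^{r-1}}{r!},$$ where the $o(1)$ term tends to $0$ as $d\to\infty$ (with $n,r$ fixed).
   Context: All graphs are finite, undirected, without loops or multiple edges. $K_n$ is the complete graph on $n$ vertices. The Cartesian product $G\square H$ has vertex set $V(G)\times V(H)$, with $(g_1,h_1)$ and $(g_2,h_2)$ adjacent iff either $g_1=g_2$ and $h_1h_2\in E(H)$, or $g_1g_2\in E(G)$ and $h_1=h_2$. $K_n^d$ (the Hamming graph of dimension $d$) is the Cartesian product of $d$ copies of $K_n$. The $r$-neighbor bootstrap percolation process on a graph $G$ starts with a set $V_0\subseteq V(G)$ of initially active vertices; for each $i\geqslant 1$, $V_i$ is the union of $V_{i-1}$ and the set of all vertices $v\in V(G)$ adjacent to at least $r$ vertices of $V_{i-1}$. The set $V_0$ is percolating if $V_t=V(G)$ for some $t\geqslant 0$. $m(G,r)$ is the minimum size of a percolating set in this process. *)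

theory Defs
  imports
    "HOL-Analysis.Analysis"
    "HOL-Library.Landau_Symbols"
    "Graph_Theory.Graph_Theory"
begin

text \<open>
  A finite simple graph is a \<open>pair_graph\<close>: finite, symmetric, loop-free, and without
  parallel arcs since arcs are pairs. An edge \<open>uv\<close> is represented by the two arcs
  \<open>(u, v)\<close> and \<open>(v, u)\<close>.
\<close>

definition complete_graph :: "nat \<Rightarrow> nat pair_pre_digraph" where
  "complete_graph n =
     \<lparr> pverts = {..<n}, parcs = {(u, v). u \<in> {..<n} \<and> v \<in> {..<n} \<and> u \<noteq> v} \<rparr>"

definition cartesian_product ::
  "'a pair_pre_digraph \<Rightarrow> 'b pair_pre_digraph \<Rightarrow> ('a \<times> 'b) pair_pre_digraph"
  (infixr \<open>\<box>\<close> 75) where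
  "G \<box> H =
     \<lparr> pverts = pverts G \<times> pverts H,
       parcs = {((g1, h1), (g2, h2)).
         (g1, h1) \<in> pverts G \<times> pverts H \<and> (g2, h2) \<in> pverts G \<times> pverts H \<and>
         (g1 = g2 \<and> (h1, h2) \<in> parcs H \<or> (g1, g2) \<in> parcs G \<and> h1 = h2)} \<rparr>"

definition relabel :: "('a \<Rightarrow> 'b) \<Rightarrow> 'a pair_pre_digraph \<Rightarrow> 'b pair_pre_digraph" where
  "relabel f G = \<lparr> pverts = f ` pverts G, parcs = map_prod f f ` parcs G \<rparr>"

text \<open>
  The iterated product \<open>G \<box> (G \<box> \<dots>)\<close> would have a vertex type depending on the number of
  factors. The \<open>d\<close>-tuples are therefore encoded as lists of length \<open>d\<close>, by relabelling
  vertices along the injection \<open>(x, xs) \<mapsto> x # xs\<close>. The empty product is the one-vertex graph.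
\<close>

primrec cartesian_power :: "'a pair_pre_digraph \<Rightarrow> nat \<Rightarrow> 'a list pair_pre_digraph" where
  "cartesian_power G 0 = \<lparr> pverts = {[]}, parcs = {} \<rparr>"
| "cartesian_power G (Suc d) = relabel (\<lambda>(x, xs). x # xs) (G \<box> cartesian_power G d)"

definition hamming_graph :: "nat \<Rightarrow> nat \<Rightarrow> nat list pair_pre_digraph" where
  "hamming_graph n d = cartesian_power (complete_graph n) d"

primrec active :: "'a pair_pre_digraph \<Rightarrow> nat \<Rightarrow> 'a set \<Rightarrow> nat \<Rightarrow> 'a set" where
  "active G r V0 0 = V0"
| "active G r V0 (Suc i) =
     active G r V0 i \<union>
     {v \<in> pverts G. r \<le> card {u \<in> active G r V0 i. (v, u) \<in> parcs G}}"

definition percolating :: "'a pair_pre_digraph \<Rightarrow> nat \<Rightarrow> 'a set \<Rightarrow> bool" where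
  "percolating G r V0 \<longleftrightarrow> V0 \<subseteq> pverts G \<and> (\<exists>t. active G r V0 t = pverts G)"

definition min_percolating :: "'a pair_pre_digraph \<Rightarrow> nat \<Rightarrow> nat" where
  "min_percolating G r = Min {card V0 | V0. percolating G r V0}"


lemma complete_graph_complete: "K\<^bsub>n\<^esub> (with_proj (complete_graph n))"
  by (auto simp: complete_digraph_pair_def complete_graph_def)

lemma pair_graph_iff:
  "pair_graph G \<longleftrightarrow> finite (pverts G) \<and> parcs G \<subseteq> pverts G \<times> pverts G \<and> sym (parcs G) \<and> irrefl (parcs G)"
proof
  assume "pair_graph G"
  then interpret pair_graph G .
  show "finite (pverts G) \<and> parcs G \<subseteq> pverts G \<times> pverts G \<and> sym (parcs G) \<and> irrefl (parcs G)"
    using pair_finite_verts in_arcsD1 in_arcsD2 pair_sym_arcs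
    by (auto simp: symmetric_def irrefl_def dest: pair_no_loops)
next
  assume *: "finite (pverts G) \<and> parcs G \<subseteq> pverts G \<times> pverts G \<and> sym (parcs G) \<and> irrefl (parcs G)"
  then have "finite (parcs G)" by (meson finite_SigmaI finite_subset)
  with * show "pair_graph G"
    by unfold_locales (auto simp: symmetric_def irrefl_def)
qed

lemma pair_graph_cartesian_product:
  assumes "pair_graph G" "pair_graph H"
  shows "pair_graph (G \<box> H)"
  using assms unfolding pair_graph_iff
  by (auto simp: cartesian_product_def sym_def irrefl_def)

lemma pverts_cartesian_power_Suc:
  "xs \<in> pverts (cartesian_power G (Suc d)) \<longleftrightarrow>
     (\<exists>x xs'. xs = x # xs' \<and> (x, xs') \<in> pverts (G \<box> cartesian_power G d))"
  by (simp add: relabel_def image_iff Bex_def split_paired_Ex conj_commute)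

lemma pverts_cartesian_power:
  "pverts (cartesian_power G d) = {xs. length xs = d \<and> set xs \<subseteq> pverts G}"
proof (induction d)
  case (Suc d)
  have "xs \<in> pverts (cartesian_power G (Suc d)) \<longleftrightarrow> length xs = Suc d \<and> set xs \<subseteq> pverts G" for xs
    unfolding pverts_cartesian_power_Suc
    by (cases xs) (auto simp: cartesian_product_def Suc)
  then show ?case by blast
qed auto

lemma parcs_cartesian_power_Suc:
  "(xs, ys) \<in> parcs (cartesian_power G (Suc d)) \<longleftrightarrow>
     (\<exists>x xs' y ys'. xs = x # xs' \<and> ys = y # ys' \<and>
        ((x, xs'), (y, ys')) \<in> parcs (G \<box> cartesian_power G d))"
  by (simp add: relabel_def image_iff Bex_def split_paired_Ex conj_ac)

lemma pair_graph_cartesian_power: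
  assumes "pair_graph G"
  shows "pair_graph (cartesian_power G d)"
proof (induction d)
  case (Suc d)
  let ?P = "G \<box> cartesian_power G d"
  have P: "finite (pverts ?P)" "parcs ?P \<subseteq> pverts ?P \<times> pverts ?P" "sym (parcs ?P)" "irrefl (parcs ?P)"
    using pair_graph_cartesian_product[OF assms Suc] by (auto simp: pair_graph_iff)
  show ?case
    unfolding pair_graph_iff
  proof (intro conjI)
    show "finite (pverts (cartesian_power G (Suc d)))"
      using P(1) by (simp add: relabel_def)
    show "parcs (cartesian_power G (Suc d)) \<subseteq>
        pverts (cartesian_power G (Suc d)) \<times> pverts (cartesian_power G (Suc d))"
      using P(2) unfolding subset_iff split_paired_All mem_Times_iff
        parcs_cartesian_power_Suc pverts_cartesian_power_Suc fst_conv snd_conv by blast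
    show "sym (parcs (cartesian_power G (Suc d)))"
      using P(3) unfolding sym_def parcs_cartesian_power_Suc by blast
    show "irrefl (parcs (cartesian_power G (Suc d)))"
      using P(4) unfolding irrefl_def parcs_cartesian_power_Suc by blast
  qed
qed (simp add: pair_graph_iff sym_def irrefl_def)

lemma pair_graph_hamming_graph: "pair_graph (hamming_graph n d)"
  unfolding hamming_graph_def
  by (intro pair_graph_cartesian_power pair_graphI_complete[OF complete_graph_complete])

lemma parcs_hamming_graph:
  "parcs (hamming_graph n d) =
     {(xs, ys). length xs = d \<and> length ys = d \<and> set xs \<subseteq> {..<n} \<and> set ys \<subseteq> {..<n} \<and>
        card {i. i < d \<and> xs ! i \<noteq> ys ! i} = 1}"
proof (induction d)
  case 0
  then show ?case by (auto simp: hamming_graph_def)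
next
  case (Suc d)
  let ?D = "\<lambda>d xs ys. {i. i < d \<and> xs ! i \<noteq> (ys ! i :: nat)}"
  have D: "card (?D (Suc d) (x # xs) (y # ys)) = (if x = y then 0 else 1) + card (?D d xs ys)"
    for x y xs ys
  proof -
    have "?D (Suc d) (x # xs) (y # ys) = (if x = y then {} else {0}) \<union> Suc ` ?D d xs ys"
      by (auto simp: less_Suc_eq_0_disj)
    then show ?thesis
      by (auto simp: card_image)
  qed
  have D0: "card (?D d xs ys) = 0 \<longleftrightarrow> xs = ys" if "length xs = d" "length ys = d" for xs ys
    using that by (auto simp: list_eq_iff_nth_eq)
  have V: "pverts (cartesian_power (complete_graph n) d) = {xs. length xs = d \<and> set xs \<subseteq> {..<n}}"
    by (simp add: pverts_cartesian_power complete_graph_def)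
  have C: "(xs, ys) \<in> parcs (hamming_graph n (Suc d)) \<longleftrightarrow>
      (\<exists>x xs' y ys'. xs = x # xs' \<and> ys = y # ys' \<and>
         ((x, xs'), (y, ys')) \<in> parcs (complete_graph n \<box> hamming_graph n d))" for xs ys
    unfolding hamming_graph_def by (rule parcs_cartesian_power_Suc)
  have "(xs, ys) \<in> parcs (hamming_graph n (Suc d)) \<longleftrightarrow>
      length xs = Suc d \<and> length ys = Suc d \<and> set xs \<subseteq> {..<n} \<and> set ys \<subseteq> {..<n} \<and>
      card (?D (Suc d) xs ys) = 1" for xs ys
  proof (cases xs; cases ys)
    fix x xs' y ys' assume *: "xs = x # xs'" "ys = y # ys'"
    show ?thesis
      using D0[of xs' ys'] D0[of xs' xs']
      by (auto simp add: * C D cartesian_product_def Suc V[folded hamming_graph_def]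
            complete_graph_def simp del: card_eq_0_iff)
  qed (auto simp: C)
  then show ?case by auto
qed

lemma min_percolating_attained:
  assumes "finite (pverts G)"
  shows "\<exists>V0. percolating G r V0 \<and> card V0 = min_percolating G r"
    and "percolating G r V0 \<Longrightarrow> min_percolating G r \<le> card V0"
proof -
  have eq: "{card V0 | V0. percolating G r V0} = card ` {V0. percolating G r V0}"
    by auto
  have "{V0. percolating G r V0} \<subseteq> Pow (pverts G)"
    by (auto simp: percolating_def)
  then have fin: "finite {card V0 | V0. percolating G r V0}"
    unfolding eq using assms by (meson finite_Pow_iff finite_imageI finite_subset)
  have "active G r (pverts G) 0 = pverts G" by simp
  then have "percolating G r (pverts G)"
    unfolding percolating_def by blast
  then have "{card V0 | V0. percolating G r V0} \<noteq> {}"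
    by blast
  from Min_in[OF fin this] show "\<exists>V0. percolating G r V0 \<and> card V0 = min_percolating G r"
    unfolding min_percolating_def by auto
  show "min_percolating G r \<le> card V0" if "percolating G r V0"
    unfolding min_percolating_def using fin that by (intro Min_le) auto
qed

end

theory Submission
  imports Defs "HOL-Computational_Algebra.Polynomial" "HOL-Real_Asymp.Real_Asymp"
begin

text \<open>
  Write \<open>m\<close> for the minimum size of a percolating set. Both bounds have the main term
  \<open>(d choose (r - 1)) / r\<close>, which is asymptotic to \<open>d ^ (r - 1) / fact r\<close> for every \<open>n\<close>.

  Lower bound (\<open>binomial_le_percolating_set\<close>): \<open>(d choose (r - 1)) \<le> r * m\<close> for \<open>d \<ge> r\<close>. Suppose that a
  vector space of functions on the edges has the property that a function in it which vanishes on \<open>r\<close>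
  edges at a vertex vanishes on all edges at this vertex. Then a function that vanishes on \<open>r\<close>
  edges at each vertex of a percolating set \<open>A\<close> vanishes on all edges, step by step along the process, so
  the dimension of the space is at most \<open>r * card A\<close> (\<open>edge_weights_bound_percolating_sets\<close>). A space
  of dimension \<open>d choose (r - 1)\<close> comes from polynomials: each vertex gets a polynomial of degree less than
  \<open>r\<close>, each edge gets a real label, the labels at a vertex being distinct, and the polynomials at both
  ends of an edge take the same value at its label. There is one such family of polynomials for every
  set \<open>S\<close> of \<open>r - 1\<close> coordinates, a product of linear factors indexed by \<open>S\<close>.

  Upper bound (\<open>percolating_seed_set\<close>, \<open>card_seed_set\<close>). Suppose that all vertices with at most \<open>r - 2\<close>
  nonzero coordinates are active; there are only \<open>O(d ^ (r - 2))\<close> of them. The 0-1 vector of a set \<open>T\<close> of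
  \<open>r - 1\<close> coordinates has \<open>r - 1\<close> active neighbours and lacks one more, and once these vectors are active
  everything else follows. The 0-1 vector of an \<open>r\<close>-set serves as the missing neighbour for all
  of the \<open>r\<close> sets \<open>T\<close> inside it, so a system of \<open>r\<close>-sets is needed that contains almost every
  \<open>r - 1\<close>-set exactly once: the \<open>r\<close>-sets whose sum is divisible by \<open>d\<close>. They are at most
  \<open>(d choose (r - 1)) / r\<close> in number and miss \<open>O(d ^ (r - 2))\<close> of the sets \<open>T\<close>, whose 0-1 vectors
  are made active from the start.
\<close>

section \<open>Percolation and closed sets\<close>

text \<open>
  Percolation is easier to use in terms of closed sets: \<open>A\<close> percolates exactly if the only closed
  set of vertices above \<open>A\<close> is the whole vertex set. One then never has to look at the time steps.
\<close>

definition percolation_closed :: "'a pair_pre_digraph \<Rightarrow> nat \<Rightarrow> 'a set \<Rightarrow> bool" where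
  "percolation_closed G r X \<longleftrightarrow>
     (\<forall>v\<in>pverts G. r \<le> card {u \<in> X. (v, u) \<in> parcs G} \<longrightarrow> v \<in> X)"

lemma percolating_iff_closed:
  assumes "pair_graph G"
  shows "percolating G r A \<longleftrightarrow>
    A \<subseteq> pverts G \<and> (\<forall>X \<subseteq> pverts G. A \<subseteq> X \<longrightarrow> percolation_closed G r X \<longrightarrow> X = pverts G)"
    (is "_ \<longleftrightarrow> ?R")
proof
  have fin: "finite (pverts G)"
    using assms by (simp add: pair_graph_iff)
  show ?R if perc: "percolating G r A"
  proof (intro conjI allI impI)
    show "A \<subseteq> pverts G"
      using perc by (simp add: percolating_def)
    fix X assume X: "X \<subseteq> pverts G" "A \<subseteq> X" "percolation_closed G r X"
    have "active G r A i \<subseteq> X" for i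
    proof (induction i)
      case (Suc i)
      have "v \<in> X" if "v \<in> pverts G" "r \<le> card {u \<in> active G r A i. (v, u) \<in> parcs G}" for v
      proof -
        have "card {u \<in> active G r A i. (v, u) \<in> parcs G} \<le> card {u \<in> X. (v, u) \<in> parcs G}"
          by (rule card_mono) (use Suc X(1) fin in \<open>auto intro: finite_subset\<close>)
        then show ?thesis
          using X(3) that by (auto simp: percolation_closed_def)
      qed
      then show ?case using Suc by auto
    qed (use X in auto)
    then show "X = pverts G"
      using perc X(1) unfolding percolating_def by (metis subset_antisym)
  qed
  show "percolating G r A" if R: ?R
  proof -
    have sub: "active G r A i \<subseteq> pverts G" for i
      by (induction i) (use R in auto)
    have bound: "\<forall>i. card (active G r A i) < Suc (card (pverts G))"
      using card_mono[OF fin sub] by (simp add: less_Suc_eq_le)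
    \<comment> \<open>the process is stationary from a step with the largest active set onwards\<close>
    obtain t where t: "card (active G r A i) \<le> card (active G r A t)" for i
      using bound ex_has_greatest_nat[of "\<lambda>_. True" 0 "\<lambda>i. card (active G r A i)" "Suc (card (pverts G))"]
      by (metis less_imp_le)
    have "active G r A t = active G r A (Suc t)"
    proof (rule card_seteq)
      show "finite (active G r A (Suc t))" by (rule finite_subset[OF sub fin])
      show "card (active G r A (Suc t)) \<le> card (active G r A t)" by (rule t)
    qed auto
    then have "percolation_closed G r (active G r A t)"
      unfolding percolation_closed_def by auto
    moreover have "A \<subseteq> active G r A i" for i
      by (induction i) auto
    ultimately have "active G r A t = pverts G"
      using R sub by blast
    then show ?thesis
      using R unfolding percolating_def by blast
  qed
qed

section \<open>The linear algebra lower bound\<close>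

text \<open>
  Gaussian elimination: one equation with a nonzero coefficient at \<open>v\<close> is used to eliminate the
  unknown \<open>v\<close> from all the others.
\<close>

lemma homogeneous_system_nontrivial_solution:
  fixes M :: "'e \<Rightarrow> 'u \<Rightarrow> real"
  assumes "finite E" "finite U" "card E < card U"
  shows "\<exists>c. (\<exists>u\<in>U. c u \<noteq> 0) \<and> (\<forall>e\<in>E. (\<Sum>u\<in>U. c u * M e u) = 0)"
  using assms
proof (induction E arbitrary: U M rule: finite_induct)
  case empty
  then obtain u where "u \<in> U" by fastforce
  then show ?case by (intro exI[of _ "\<lambda>_. 1"]) auto
next
  case (insert e E)
  show ?case
  proof (cases "\<exists>v\<in>U. M e v \<noteq> 0")
    case False
    have "card E < card U" using insert by simp
    from insert.IH[OF insert.prems(1) this] obtain c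
      where "\<exists>u\<in>U. c u \<noteq> 0" "\<forall>e\<in>E. (\<Sum>u\<in>U. c u * M e u) = 0" by blast
    then show ?thesis using False by (intro exI[of _ c]) auto
  next
    case True
    then obtain v where v: "v \<in> U" "M e v \<noteq> 0" by blast
    define V where "V = U - {v}"
    have U: "U = insert v V" "v \<notin> V" and fV: "finite V"
      using v insert.prems by (auto simp: V_def)
    have cV: "card E < card V" using insert U fV by simp
    \<comment> \<open>the system left after subtracting the multiple of row \<open>e\<close> that clears column \<open>v\<close>\<close>
    define M' where "M' = (\<lambda>f u. M f u - M f v * M e u / M e v)"
    from insert.IH[OF fV cV, of M'] obtain c where c:
      "\<exists>u\<in>V. c u \<noteq> 0" "\<forall>f\<in>E. (\<Sum>u\<in>V. c u * M' f u) = 0" by blast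
    define s where "s = (\<Sum>u\<in>V. c u * M e u)"
    define c' where "c' = c(v := - s / M e v)"
    have sum': "(\<Sum>u\<in>U. c' u * M f u) = (\<Sum>u\<in>V. c u * M f u) - s / M e v * M f v" for f
    proof -
      have "(\<Sum>u\<in>V. c' u * M f u) = (\<Sum>u\<in>V. c u * M f u)"
        by (rule sum.cong) (use U in \<open>auto simp: c'_def\<close>)
      then show ?thesis using fV U by (simp add: c'_def)
    qed
    have "(\<Sum>u\<in>U. c' u * M f u) = 0" if "f \<in> insert e E" for f
    proof (cases "f = e")
      case True
      then show ?thesis using v by (simp add: sum' s_def)
    next
      case False
      have "(\<Sum>u\<in>V. c u * M' f u) = (\<Sum>u\<in>V. c u * M f u - (M f v / M e v) * (c u * M e u))"
        by (rule sum.cong) (auto simp: M'_def algebra_simps)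
      also have "\<dots> = (\<Sum>u\<in>V. c u * M f u) - M f v / M e v * s"
        by (simp add: sum_subtractf s_def sum_distrib_left)
      finally show ?thesis using c(2) that False by (simp add: sum' mult.commute)
    qed
    moreover have "\<exists>u\<in>U. c' u \<noteq> 0" using c(1) U by (auto simp: c'_def)
    ultimately show ?thesis by blast
  qed
qed

text \<open>
  Call a combination of the weights \<open>w u\<close> dead at a vertex if it
  vanishes on all edges there. By \<open>local_determined\<close> a combination that vanishes on \<open>r\<close> edges at a
  vertex is dead there. It takes at most \<open>r\<close> linear conditions per vertex of \<open>A\<close> to make a combination
  dead on \<open>A\<close>, and then it dies along the percolation process: a vertex with \<open>r\<close> dead neighbours sees
  \<open>r\<close> edges of weight zero. With more than \<open>r * card A\<close> weights a nontrivial combination would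
  satisfy all the conditions, be dead everywhere, and contradict \<open>indep\<close>.
\<close>

lemma edge_weights_bound_percolating_sets:
  fixes w :: "'u \<Rightarrow> 'a \<times> 'a \<Rightarrow> real"
  assumes G: "pair_graph G" and perc: "percolating G r A" and U: "finite U"
    and sym: "\<And>u x y. u \<in> U \<Longrightarrow> (x, y) \<in> parcs G \<Longrightarrow> w u (x, y) = w u (y, x)"
    and local_determined: "\<And>c v N y. v \<in> pverts G \<Longrightarrow> N \<subseteq> {y. (v, y) \<in> parcs G} \<Longrightarrow> r \<le> card N \<Longrightarrow>
       \<forall>y\<in>N. (\<Sum>u\<in>U. c u * w u (v, y)) = 0 \<Longrightarrow> (v, y) \<in> parcs G \<Longrightarrow>
       (\<Sum>u\<in>U. c u * w u (v, y)) = 0"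
    and indep: "\<And>c u. \<forall>e\<in>parcs G. (\<Sum>u\<in>U. c u * w u e) = 0 \<Longrightarrow> u \<in> U \<Longrightarrow> c u = 0"
  shows "card U \<le> r * card A"
proof (rule ccontr)
  assume less: "\<not> ?thesis"
  define nbrs where "nbrs = (\<lambda>v. {y. (v, y) \<in> parcs G})"
  have finV: "finite (pverts G)" and arcs: "parcs G \<subseteq> pverts G \<times> pverts G" "sym (parcs G)"
    using G by (auto simp: pair_graph_iff)
  have fin_nbrs: "finite (nbrs v)" for v
    by (rule finite_subset[OF _ finV]) (use arcs in \<open>auto simp: nbrs_def\<close>)
  have A: "A \<subseteq> pverts G" "finite A"
    using perc finV by (auto simp: percolating_def intro: finite_subset)
  \<comment> \<open>at a vertex of degree below \<open>r\<close> all edges are taken\<close>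
  have "\<exists>N \<subseteq> nbrs v. card N \<le> r \<and> (r \<le> card N \<or> N = nbrs v)" for v
  proof (cases "r \<le> card (nbrs v)")
    case True
    then show ?thesis by (metis obtain_subset_with_card_n le_refl)
  qed auto
  then obtain N where N: "\<And>v. N v \<subseteq> nbrs v" "\<And>v. card (N v) \<le> r"
    "\<And>v. r \<le> card (N v) \<or> N v = nbrs v" by metis
  define E where "E = Sigma A N"
  have finN: "finite (N v)" for v using N(1) fin_nbrs finite_subset by blast
  have "card E \<le> r * card A"
    using sum_bounded_above[of A "\<lambda>v. card (N v)" r] N(2) A(2) finN
    by (simp add: E_def mult.commute)
  with less have "card E < card U" by simp
  moreover have "finite E" using A finN by (simp add: E_def)
  ultimately obtain c where c: "\<exists>u\<in>U. c u \<noteq> 0" "\<forall>e\<in>E. (\<Sum>u\<in>U. c u * w u e) = 0"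
    using homogeneous_system_nontrivial_solution[OF _ U, of E "\<lambda>e u. w u e"] by blast
  define f where "f = (\<lambda>e. \<Sum>u\<in>U. c u * w u e)"
  have local: "f (v, y) = 0"
    if "v \<in> pverts G" "M \<subseteq> nbrs v" "r \<le> card M" "\<forall>y\<in>M. f (v, y) = 0" "y \<in> nbrs v" for v M y
    using local_determined[of v M c y] that unfolding f_def nbrs_def by blast
  have f_sym: "f (x, y) = f (y, x)" if "(x, y) \<in> parcs G" for x y
    unfolding f_def by (rule sum.cong) (use sym that in auto)
  define X where "X = {v \<in> pverts G. \<forall>y\<in>nbrs v. f (v, y) = 0}"
  have "A \<subseteq> X"
  proof
    fix v assume v: "v \<in> A"
    then have "\<forall>y\<in>N v. f (v, y) = 0" using c(2) by (auto simp: E_def f_def)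
    then show "v \<in> X"
      using N(3)[of v] local[OF _ N(1), of v] A(1) v by (auto simp: X_def)
  qed
  moreover have "percolation_closed G r X"
    unfolding percolation_closed_def
  proof (intro ballI impI)
    fix v assume v: "v \<in> pverts G" "r \<le> card {u \<in> X. (v, u) \<in> parcs G}"
    have "f (v, u) = 0" if "u \<in> X" "(v, u) \<in> parcs G" for u
      using that f_sym[OF that(2)] arcs(2) by (auto simp: X_def nbrs_def dest: symD)
    then show "v \<in> X"
      using v local[OF v(1) _ v(2)] by (auto simp: X_def nbrs_def)
  qed
  ultimately have "X = pverts G"
    using perc unfolding percolating_iff_closed[OF G] by (auto simp: X_def)
  then have "\<forall>e\<in>parcs G. f e = 0"
    using arcs(1) by (auto simp: X_def nbrs_def)
  then show False using indep[of c] c(1) unfolding f_def by blast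
qed

section \<open>Neighbours in the Hamming graph\<close>

lemma pverts_hamming_graph:
  "pverts (hamming_graph n d) = {v. length v = d \<and> (\<forall>i<d. v ! i < n)}"
  by (auto simp: hamming_graph_def pverts_cartesian_power complete_graph_def subset_iff in_set_conv_nth)

lemma hamming_arc_iff:
  assumes v: "v \<in> pverts (hamming_graph n d)"
  shows "(v, y) \<in> parcs (hamming_graph n d) \<longleftrightarrow> (\<exists>i<d. \<exists>b<n. b \<noteq> v ! i \<and> y = v[i := b])"
proof
  assume arc: "(v, y) \<in> parcs (hamming_graph n d)"
  then have l: "length y = d" "length v = d" "set y \<subseteq> {..<n}"
    and "card {i. i < d \<and> v ! i \<noteq> y ! i} = 1"
    by (auto simp: parcs_hamming_graph)
  then obtain i where i: "{i. i < d \<and> v ! i \<noteq> y ! i} = {i}"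
    by (auto simp: card_1_singleton_iff)
  then have id: "i < d" "v ! i \<noteq> y ! i"
    and eq: "\<And>j. j < d \<Longrightarrow> j \<noteq> i \<Longrightarrow> v ! j = y ! j"
    by blast+
  then have "y = v[i := y ! i]"
    using l by (intro nth_equalityI) (simp_all add: nth_list_update)
  moreover have "y ! i < n" using l id by (auto simp: subset_iff)
  ultimately show "\<exists>i<d. \<exists>b<n. b \<noteq> v ! i \<and> y = v[i := b]" using id by metis
next
  assume "\<exists>i<d. \<exists>b<n. b \<noteq> v ! i \<and> y = v[i := b]"
  then obtain i b where ib: "i < d" "b < n" "b \<noteq> v ! i" "y = v[i := b]" by blast
  have l: "length v = d" "set v \<subseteq> {..<n}"
    using v by (auto simp: hamming_graph_def pverts_cartesian_power complete_graph_def)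
  have "{j. j < d \<and> v ! j \<noteq> y ! j} = {i}"
    using ib l by (auto simp: nth_list_update split: if_splits)
  moreover have "set y \<subseteq> {..<n}"
    using l ib set_update_subset_insert[of v i b] by auto
  ultimately show "(v, y) \<in> parcs (hamming_graph n d)"
    using l ib by (simp add: parcs_hamming_graph)
qed

lemma percolation_closed_hammingD:
  assumes cl: "percolation_closed (hamming_graph n d) r X"
    and v: "v \<in> pverts (hamming_graph n d)"
    and P: "P \<subseteq> {(i, b). i < d \<and> b < n \<and> b \<noteq> v ! i}" "\<And>i b. (i, b) \<in> P \<Longrightarrow> v[i := b] \<in> X"
    and r: "r \<le> card P"
  shows "v \<in> X"
proof -
  let ?f = "\<lambda>(i, b). v[i := b]"
  have l: "length v = d" using v by (simp add: pverts_hamming_graph)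
  have "inj_on ?f P"
  proof (rule inj_onI, clarify)
    fix i b j c assume *: "(i, b) \<in> P" "(j, c) \<in> P" "v[i := b] = v[j := c]"
    have ij: "i < d" "j < d" "b \<noteq> v ! i"
      using P(1) *(1,2) by auto
    then have "i = j"
      using arg_cong[OF *(3), of "\<lambda>u. u ! i"] l by (auto simp: nth_list_update split: if_splits)
    moreover have "v[i := b] ! i = b" "v[j := c] ! j = c"
      using ij l by simp_all
    ultimately show "i = j \<and> b = c" using * by metis
  qed
  then have "card P = card (?f ` P)" by (simp add: card_image)
  also have "\<dots> \<le> card {u \<in> X. (v, u) \<in> parcs (hamming_graph n d)}"
  proof (rule card_mono)
    have "parcs (hamming_graph n d) \<subseteq> pverts (hamming_graph n d) \<times> pverts (hamming_graph n d)"
      "finite (pverts (hamming_graph n d))"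
      using pair_graph_hamming_graph by (auto simp: pair_graph_iff)
    then show "finite {u \<in> X. (v, u) \<in> parcs (hamming_graph n d)}"
      by (auto elim!: rev_finite_subset)
    show "?f ` P \<subseteq> {u \<in> X. (v, u) \<in> parcs (hamming_graph n d)}"
      using P hamming_arc_iff[OF v] by fast
  qed
  finally show ?thesis
    using cl v r by (auto simp: percolation_closed_def)
qed

section \<open>Edge weights on the Hamming graph\<close>

text \<open>
  Every vertex \<open>v\<close> and every set \<open>S\<close> of coordinates carry the polynomial
  \<open>\<Prod>i\<in>S. coord_factor n i (v ! i)\<close> in one variable \<open>t\<close>, of degree at most \<open>card S\<close>. The weight of an
  edge is the value of this polynomial at the label of the edge, and the two endpoints have to agree
  on it. They do because
    \<open>a * (t - 2 n i - a) - b * (t - 2 n i - b) = (a - b) * (t - (2 n i + a + b))\<close>,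
  so changing coordinate \<open>i\<close> from \<open>a\<close> to \<open>b\<close> does not alter the value at \<open>t = 2 n i + a + b\<close>, which is
  the label chosen for such an edge. The shift \<open>2 n i\<close> keeps the labels of different directions apart, as
  \<open>a + b < 2 n\<close>. The factor vanishes at \<open>a = 0\<close>, which makes the weights of different sets independent.
\<close>

definition coord_factor :: "nat \<Rightarrow> nat \<Rightarrow> nat \<Rightarrow> real poly" where
  "coord_factor n i a = smult (real a) [:- real (2 * n * i + a), 1:]"

text \<open>
  On an arc the sum has a single term, for the coordinate in which its endpoints differ.
\<close>

definition arc_label :: "nat \<Rightarrow> nat list \<times> nat list \<Rightarrow> real" where
  "arc_label n = (\<lambda>(x, y). \<Sum>i | i < length x \<and> x ! i \<noteq> y ! i. real (2 * n * i + x ! i + y ! i))"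

definition arc_weight :: "nat \<Rightarrow> nat set \<Rightarrow> nat list \<times> nat list \<Rightarrow> real" where
  "arc_weight n S e = poly (\<Prod>i\<in>S. coord_factor n i (fst e ! i)) (arc_label n e)"

lemma arc_label_update:
  assumes "i < length v" "b \<noteq> v ! i"
  shows "arc_label n (v, v[i := b]) = real (2 * n * i + (v ! i + b))"
    and "arc_label n (v[i := b], v) = real (2 * n * i + (v ! i + b))"
proof -
  have "{j. j < length v \<and> v ! j \<noteq> v[i := b] ! j} = {i}"
    "{j. j < length v \<and> v[i := b] ! j \<noteq> v ! j} = {i}"
    using assms by (auto simp: nth_list_update split: if_splits)
  then show "arc_label n (v, v[i := b]) = real (2 * n * i + (v ! i + b))"
    "arc_label n (v[i := b], v) = real (2 * n * i + (v ! i + b))"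
    using assms by (simp_all add: arc_label_def)
qed

lemma arc_weight_sym:
  assumes "(x, y) \<in> parcs (hamming_graph n d)"
  shows "arc_weight n S (x, y) = arc_weight n S (y, x)"
proof -
  have x: "x \<in> pverts (hamming_graph n d)"
    using assms pair_graph_hamming_graph by (auto simp: pair_graph_iff)
  then obtain i b where i: "i < length x" "b \<noteq> x ! i" "y = x[i := b]"
    using assms hamming_arc_iff[OF x] by (auto simp: pverts_hamming_graph)
  have "poly (coord_factor n j (x ! j)) (real (2 * n * i + (x ! i + b))) =
        poly (coord_factor n j (y ! j)) (real (2 * n * i + (x ! i + b)))" for j
    using i by (cases "j = i") (auto simp: coord_factor_def algebra_simps)
  then show ?thesis
    using arc_label_update[OF i(1,2)] i(3) by (simp add: arc_weight_def poly_prod)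
qed

lemma arc_label_inj:
  assumes v: "v \<in> pverts (hamming_graph n d)"
  shows "inj_on (\<lambda>y. arc_label n (v, y)) {y. (v, y) \<in> parcs (hamming_graph n d)}"
proof (rule inj_onI)
  fix y z assume "y \<in> {y. (v, y) \<in> parcs (hamming_graph n d)}"
    "z \<in> {y. (v, y) \<in> parcs (hamming_graph n d)}"
  then obtain i b j c where y: "i < d" "b < n" "b \<noteq> v ! i" "y = v[i := b]"
    and z: "j < d" "c < n" "c \<noteq> v ! j" "z = v[j := c]"
    using hamming_arc_iff[OF v] by auto
  assume eq: "arc_label n (v, y) = arc_label n (v, z)"
  have l: "length v = d" "v ! i < n" "v ! j < n" using v y z by (auto simp: pverts_hamming_graph)
  have eq': "2 * n * i + (v ! i + b) = 2 * n * j + (v ! j + c)"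
  proof -
    have "arc_label n (v, y) = real (2 * n * i + (v ! i + b))"
      "arc_label n (v, z) = real (2 * n * j + (v ! j + c))"
      using arc_label_update(1)[of i v b n] arc_label_update(1)[of j v c n] y z l
      by simp_all
    with eq show ?thesis by (metis of_nat_eq_iff)
  qed
  \<comment> \<open>division by \<open>2 * n\<close> reads off the direction, since the two values add up to less than \<open>2 * n\<close>\<close>
  have "i = (2 * n * i + (v ! i + b)) div (2 * n)" "j = (2 * n * j + (v ! j + c)) div (2 * n)"
    using l y z by (simp_all add: div_mult_self4)
  with eq' have "i = j" by metis
  with eq' show "y = z" using y z by simp
qed

lemma sum_arc_weight:
  "(\<Sum>S\<in>U. c S * arc_weight n S (v, y)) =
     poly (\<Sum>S\<in>U. smult (c S) (\<Prod>i\<in>S. coord_factor n i (v ! i))) (arc_label n (v, y))"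
  by (simp add: arc_weight_def poly_sum)

text \<open>
  At a fixed vertex a combination of weights is a polynomial of degree less than \<open>r\<close>, evaluated at the
  distinct labels of the edges there. It cannot have \<open>r\<close> zeros among them without being zero.
\<close>

lemma local_polynomial_eq_0:
  assumes v: "v \<in> pverts (hamming_graph n d)" and N: "N \<subseteq> {y. (v, y) \<in> parcs (hamming_graph n d)}"
    and r: "r \<le> card N" "1 \<le> r" and U: "finite U" "\<And>S. S \<in> U \<Longrightarrow> card S = r - 1"
    and zero: "\<forall>y\<in>N. (\<Sum>S\<in>U. c S * arc_weight n S (v, y)) = 0"
  shows "(\<Sum>S\<in>U. smult (c S) (\<Prod>i\<in>S. coord_factor n i (v ! i))) = 0" (is "?p = 0")
proof (rule poly_eqI_degree)
  let ?T = "(\<lambda>y. arc_label n (v, y)) ` N"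
  have "card ?T = card N"
    by (intro card_image inj_on_subset[OF arc_label_inj[OF v] N])
  then have T: "r \<le> card ?T" using r by simp
  have "degree (\<Prod>i\<in>S. coord_factor n i (v ! i)) \<le> r - 1" if "S \<in> U" for S
  proof (cases "finite S")
    case True
    have "degree (coord_factor n i (v ! i)) \<le> 1" for i
      unfolding coord_factor_def by (rule order.trans[OF degree_smult_le]) simp
    then have "degree (\<Prod>i\<in>S. coord_factor n i (v ! i)) \<le> (\<Sum>i\<in>S. 1)"
      by (intro order.trans[OF degree_prod_sum_le[OF True]] sum_mono) simp
    then show ?thesis using U(2)[OF that] by simp
  qed simp
  then have "degree ?p \<le> r - 1"
    by (intro degree_sum_le U(1)) (use degree_smult_le order.trans in blast)
  then show "degree ?p < card ?T" "degree (0 :: real poly) < card ?T"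
    using T r(2) by auto
  show "poly ?p x = poly 0 x" if "x \<in> ?T" for x
    using that zero by (auto simp: sum_arc_weight)
qed

definition indicator_vertex :: "nat \<Rightarrow> nat set \<Rightarrow> nat list" where
  "indicator_vertex d S = map (\<lambda>i. if i \<in> S then 1 else 0) [0..<d]"

lemma indicator_vertex_simps [simp]:
  "length (indicator_vertex d S) = d"
  "i < d \<Longrightarrow> indicator_vertex d S ! i = (if i \<in> S then 1 else 0)"
  by (simp_all add: indicator_vertex_def)

lemma indicator_vertex_in_hamming:
  "2 \<le> n \<Longrightarrow> indicator_vertex d S \<in> pverts (hamming_graph n d)"
  by (auto simp: pverts_hamming_graph)

text \<open>
  The weights of the \<open>r - 1\<close>-element sets are independent: at the indicator vertex of \<open>S\<close> the
  polynomials of all other sets of the same size vanish, because such a set has an element outside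
  \<open>S\<close>, where the coordinate is \<open>0\<close>. The combination there is a multiple of the nonzero polynomial of
  \<open>S\<close>, and it has at least \<open>d\<close> zeros, one for each direction.
\<close>

lemma binomial_le_percolating_set:
  assumes n: "2 \<le> n" and r: "1 \<le> r" "r \<le> d" and perc: "percolating (hamming_graph n d) r A"
  shows "d choose (r - 1) \<le> r * card A"
proof -
  define U where "U = {S. S \<subseteq> {..<d} \<and> card S = r - 1}"
  have U: "finite U" by (simp add: U_def)
  have finU: "finite S" if "S \<in> U" for S
    using that by (auto simp: U_def intro: finite_subset)
  have cardU: "card S = r - 1" if "S \<in> U" for S using that by (simp add: U_def)
  have "card U \<le> r * card A"
  proof (rule edge_weights_bound_percolating_sets[OF pair_graph_hamming_graph perc U,
        where w = "arc_weight n"])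
    fix c v N y
    assume *: "v \<in> pverts (hamming_graph n d)" "N \<subseteq> {y. (v, y) \<in> parcs (hamming_graph n d)}"
      "r \<le> card N" "\<forall>y\<in>N. (\<Sum>S\<in>U. c S * arc_weight n S (v, y)) = 0"
    show "(\<Sum>S\<in>U. c S * arc_weight n S (v, y)) = 0"
      using local_polynomial_eq_0[OF *(1-3) r(1) U cardU *(4)] by (simp add: sum_arc_weight)
  next
    fix c :: "nat set \<Rightarrow> real" and S
    assume zero: "\<forall>e\<in>parcs (hamming_graph n d). (\<Sum>S\<in>U. c S * arc_weight n S e) = 0" and S: "S \<in> U"
    define v where "v = indicator_vertex d S"
    have v: "v \<in> pverts (hamming_graph n d)" "length v = d" "\<And>i. i < d \<Longrightarrow> v ! i \<le> 1"
      using n by (simp_all add: v_def indicator_vertex_in_hamming)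
    \<comment> \<open>one neighbour in each direction, obtained by flipping a bit\<close>
    define N where "N = (\<lambda>i. v[i := 1 - v ! i]) ` {..<d}"
    have flip: "v[i := 1 - v ! i] ! j \<noteq> v ! j \<longleftrightarrow> i = j" if "i < d" "j < d" for i j
      using v(2) v(3)[of j] that by (cases "v ! j") (auto simp: nth_list_update)
    have "inj_on (\<lambda>i. v[i := 1 - v ! i]) {..<d}"
      by (rule inj_onI) (use flip in \<open>metis lessThan_iff\<close>)
    then have "card N = d" by (simp add: N_def card_image)
    moreover have N: "N \<subseteq> {y. (v, y) \<in> parcs (hamming_graph n d)}"
    proof -
      have "1 - v ! i < n" "1 - v ! i \<noteq> v ! i" if "i < d" for i
        using n v(3)[OF that] by (cases "v ! i"; auto)+
      then show ?thesis unfolding N_def using hamming_arc_iff[OF v(1)] by blast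
    qed
    ultimately have "(\<Sum>T\<in>U. smult (c T) (\<Prod>i\<in>T. coord_factor n i (v ! i))) = 0"
      by (intro local_polynomial_eq_0[OF v(1) N _ r(1) U cardU]) (use r zero N in auto)
    moreover have "(\<Prod>i\<in>T. coord_factor n i (v ! i)) = 0" if T: "T \<in> U" "T \<noteq> S" for T
    proof -
      have "\<not> T \<subseteq> S"
        using T card_subset_eq[OF finU[OF S], of T] cardU S by auto
      then obtain i where "i \<in> T" "i \<notin> S" by blast
      then have "coord_factor n i (v ! i) = 0"
        using T by (auto simp: coord_factor_def v_def U_def)
      then show ?thesis using \<open>i \<in> T\<close> finU[OF T(1)] by (auto simp: prod_zero_iff)
    qed
    ultimately have "smult (c S) (\<Prod>i\<in>S. coord_factor n i (v ! i)) = 0"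
      using sum.remove[OF U S, of "\<lambda>T. smult (c T) (\<Prod>i\<in>T. coord_factor n i (v ! i))"] by simp
    moreover have "(\<Prod>i\<in>S. coord_factor n i (v ! i)) \<noteq> 0"
      using finU[OF S] S by (auto simp: prod_zero_iff coord_factor_def v_def U_def)
    ultimately show "c S = 0" by simp
  qed (use arc_weight_sym in blast)
  then show ?thesis by (simp add: U_def n_subsets)
qed

section \<open>A small percolating set\<close>

definition support :: "nat list \<Rightarrow> nat set" where
  "support v = {i. i < length v \<and> v ! i \<noteq> 0}"

definition small_support_vertices :: "nat \<Rightarrow> nat \<Rightarrow> nat \<Rightarrow> nat list set" where
  "small_support_vertices n d k = {v \<in> pverts (hamming_graph n d). card (support v) \<le> k}"

lemma finite_support [simp]: "finite (support v)"
  by (simp add: support_def)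

text \<open>
  Each coordinate of the support costs a choice of a position and a value.
\<close>

lemma card_small_support_vertices:
  assumes "1 \<le> d"
  shows "card (small_support_vertices n d k) \<le> (d * n) ^ k"
proof (induction k)
  case 0
  have "small_support_vertices n d 0 \<subseteq> {replicate d 0}"
    by (auto simp: small_support_vertices_def pverts_hamming_graph support_def list_eq_iff_nth_eq)
  then have "card (small_support_vertices n d 0) \<le> card {replicate d (0::nat)}"
    by (rule card_mono[rotated]) simp
  then show ?case by simp
next
  case (Suc k)
  let ?f = "\<lambda>(v, i, b). v[i := b]" and ?P = "small_support_vertices n d k \<times> {..<d} \<times> {..<n}"
  have "finite (small_support_vertices n d k)"
    using pair_graph_hamming_graph[of n d] by (simp add: small_support_vertices_def pair_graph_iff)
  then have fin: "finite ?P" by simp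
  have "v \<in> ?f ` ?P" if v: "v \<in> small_support_vertices n d (Suc k)" for v
  proof -
    have l: "length v = d" "\<forall>i<d. v ! i < n" "card (support v) \<le> Suc k"
      using v by (auto simp: small_support_vertices_def pverts_hamming_graph)
    \<comment> \<open>for the zero vector any position will do: it is overwritten by the value \<open>0\<close>\<close>
    obtain i where i: "i < d" "support v = {} \<or> i \<in> support v"
    proof (cases "support v = {}")
      case True
      then show ?thesis using that[of 0] assms by simp
    next
      case False
      then show ?thesis using that l(1) by (auto simp: support_def)
    qed
    have "v ! i < n" using l(2) i(1) by blast
    have "support (v[i := 0]) = support v - {i}"
      using i l(1) by (auto simp: support_def nth_list_update split: if_splits)
    then have "card (support (v[i := 0])) \<le> k"
      using i(2) l(3) by (elim disjE) simp_all
    moreover have "\<forall>j<d. v[i := 0] ! j < n"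
      using \<open>v ! i < n\<close> l(1,2) by (metis gr_zeroI less_nat_zero_code nth_list_update_eq nth_list_update_neq)
    ultimately have "v[i := 0] \<in> small_support_vertices n d k"
      using l(1) unfolding small_support_vertices_def pverts_hamming_graph by simp
    then have "(v[i := 0], i, v ! i) \<in> ?P" using i(1) \<open>v ! i < n\<close> by simp
    moreover have "v = ?f (v[i := 0], i, v ! i)" by simp
    ultimately show ?thesis by (rule rev_image_eqI)
  qed
  then have "card (small_support_vertices n d (Suc k)) \<le> card ?P"
    by (intro surj_card_le[OF fin] subsetI)
  also have "\<dots> \<le> (d * n) ^ k * (d * n)"
    using Suc by (simp add: card_cartesian_product)
  finally show ?case by (simp add: mult.commute)
qed

text \<open>
  The \<open>r\<close>-element sets with sum divisible by \<open>d\<close> are almost a Steiner system: an \<open>r - 1\<close>-element set \<open>T\<close>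
  is contained in the block \<open>insert x T\<close> for the one residue \<open>x\<close> with \<open>x + \<Sum>T\<close> divisible by \<open>d\<close>, unless
  this \<open>x\<close> already belongs to \<open>T\<close>. The exceptional sets \<open>T\<close> are the uncompletable ones.
\<close>

definition zero_sum_blocks :: "nat \<Rightarrow> nat \<Rightarrow> nat set set" where
  "zero_sum_blocks d r = {S. S \<subseteq> {..<d} \<and> card S = r \<and> d dvd \<Sum>S}"

definition uncompletable_sets :: "nat \<Rightarrow> nat \<Rightarrow> nat set set" where
  "uncompletable_sets d k = {T. T \<subseteq> {..<d} \<and> card T = k \<and> (\<exists>x\<in>T. d dvd x + \<Sum>T)}"

lemma ex_completing_residue:
  assumes "0 < (d::nat)"
  shows "\<exists>x<d. d dvd x + s"
proof (cases "d dvd s")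
  case True
  then show ?thesis using assms by (intro exI[of _ 0]) simp
next
  case False
  then have "0 < s mod d" by (simp add: dvd_eq_mod_eq_0)
  moreover have "d dvd (d - s mod d) + s"
  proof -
    have "d - s mod d + s = d - s mod d + (s mod d + d * (s div d))"
      by (simp only: mod_mult_div_eq)
    also have "\<dots> = d + d * (s div d)" using mod_less_divisor[OF assms, of s] by linarith
    also have "\<dots> = d * (1 + s div d)" by simp
    finally show ?thesis by simp
  qed
  ultimately show ?thesis using assms by (intro exI[of _ "d - s mod d"]) simp
qed

lemma completing_residue_unique:
  assumes "x < d" "y < (d::nat)" "d dvd x + s" "d dvd y + s"
  shows "x = y"
proof -
  have "int d dvd (int x + int s) - (int y + int s)"
    using assms(3,4) by (intro dvd_diff) (metis int_dvd_int_iff of_nat_add)+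
  then have "int d dvd int x - int y" by simp
  then have "int x mod int d = int y mod int d" by (simp add: mod_eq_dvd_iff)
  then show ?thesis using assms(1,2) by simp
qed

text \<open>
  A block contains \<open>r\<close> sets of size \<open>r - 1\<close>, and no set of this size lies in two blocks.
\<close>

lemma card_zero_sum_blocks: "r * card (zero_sum_blocks d r) \<le> d choose (r - 1)"
proof -
  let ?P = "Sigma (zero_sum_blocks d r) id" and ?f = "\<lambda>(S, x). S - {x :: nat}"
  have fin: "finite (zero_sum_blocks d r)" "\<And>S. S \<in> zero_sum_blocks d r \<Longrightarrow> finite S"
    by (auto simp: zero_sum_blocks_def intro: finite_subset)
  have "inj_on ?f ?P"
  proof (rule inj_onI, clarsimp)
    fix S x S' x'
    assume *: "S \<in> zero_sum_blocks d r" "x \<in> S" "S' \<in> zero_sum_blocks d r" "x' \<in> S'"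
      "S - {x} = S' - {x'}"
    have x: "x < d" "x' < d" using * by (auto simp: zero_sum_blocks_def)
    have "\<Sum>S = x + \<Sum>(S - {x})" "\<Sum>S' = x' + \<Sum>(S - {x})"
      using * fin by (auto simp: sum.remove)
    then have "d dvd x + \<Sum>(S - {x})" "d dvd x' + \<Sum>(S - {x})"
      using * by (auto simp: zero_sum_blocks_def)
    then have "x = x'" by (rule completing_residue_unique[OF x])
    then show "S = S' \<and> x = x'" using * by blast
  qed
  then have "card ?P = card (?f ` ?P)" by (simp add: card_image)
  also have "\<dots> \<le> card {T. T \<subseteq> {..<d} \<and> card T = r - 1}"
    by (rule card_mono) (auto simp: zero_sum_blocks_def dest: finite_subset)
  also have "\<dots> = d choose (r - 1)" by (simp add: n_subsets)
  also have "card ?P = (\<Sum>S\<in>zero_sum_blocks d r. card S)"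
    using fin by simp
  also have "\<dots> = (\<Sum>S\<in>zero_sum_blocks d r. r)"
    by (rule sum.cong) (auto simp: zero_sum_blocks_def)
  finally show ?thesis by (simp add: mult.commute)
qed

text \<open>
  If \<open>T = insert x R\<close> is uncompletable because of \<open>x\<close>, then \<open>2 * x + \<Sum>R\<close> is a multiple of \<open>d\<close>. For a
  given \<open>R\<close> at most three multiples of \<open>d\<close> are in the range of this expression, so \<open>R\<close> determines \<open>x\<close> up to
  three possibilities. Hence the uncompletable sets are fewer than all sets by a factor of order \<open>d\<close>.
\<close>

lemma card_uncompletable_sets:
  assumes "0 < d"
  shows "card (uncompletable_sets d (Suc k)) \<le> 3 * d ^ k"
proof -
  define B where "B = {R. R \<subseteq> {..<d} \<and> card R = k}"
  define X where "X = (\<lambda>R. {x. x < d \<and> d dvd 2 * x + \<Sum>R})"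
  have finB: "finite B" by (simp add: B_def)
  have finX: "finite (X R)" for R by (simp add: X_def)
  have cardX: "card (X R) \<le> 3" for R
  proof -
    have "inj_on (\<lambda>x. (2 * x + \<Sum>R) div d) (X R)"
    proof (rule inj_onI)
      fix x y assume xy: "x \<in> X R" "y \<in> X R" "(2 * x + \<Sum>R) div d = (2 * y + \<Sum>R) div d"
      then have "2 * x + \<Sum>R = 2 * y + \<Sum>R"
        unfolding X_def by (metis (mono_tags, lifting) dvd_div_mult_self mem_Collect_eq)
      then show "x = y" by simp
    qed
    moreover have "(\<lambda>x. (2 * x + \<Sum>R) div d) ` X R \<subseteq> {\<Sum>R div d..\<Sum>R div d + 2}"
    proof clarify
      fix x assume "x \<in> X R"
      then have "x < d" by (simp add: X_def)
      then have "(2 * x + \<Sum>R) div d \<le> (2 * d + \<Sum>R) div d"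
        by (intro div_le_mono) simp
      then show "(2 * x + \<Sum>R) div d \<in> {\<Sum>R div d..\<Sum>R div d + 2}"
        using assms by (simp add: div_le_mono)
    qed
    ultimately have "card (X R) \<le> card {\<Sum>R div d..\<Sum>R div d + 2}"
      by (metis card_image card_mono finite_atLeastAtMost)
    then show ?thesis by simp
  qed
  have "T \<in> (\<lambda>(R, x). insert x R) ` Sigma B X" if T: "T \<in> uncompletable_sets d (Suc k)" for T
  proof -
    have fin: "finite T" using T by (auto simp: uncompletable_sets_def intro: finite_subset)
    obtain x where x: "x \<in> T" "d dvd x + \<Sum>T" using T by (auto simp: uncompletable_sets_def)
    have "\<Sum>T = x + \<Sum>(T - {x})" using fin x by (simp add: sum.remove)
    then have "x \<in> X (T - {x})" using x T by (auto simp: X_def uncompletable_sets_def mult_2 add.assoc)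
    moreover have "T - {x} \<in> B" using T x fin by (auto simp: B_def uncompletable_sets_def)
    ultimately show ?thesis using x(1) by (intro image_eqI[of _ _ "(T - {x}, x)"]) auto
  qed
  then have "card (uncompletable_sets d (Suc k)) \<le> card (Sigma B X)"
    by (intro surj_card_le[where f = "\<lambda>(R, x). insert x R"]) (use finB finX in auto)
  also have "\<dots> = (\<Sum>R\<in>B. card (X R))" using finB finX by simp
  also have "\<dots> \<le> card B * 3" using sum_bounded_above[of B "\<lambda>R. card (X R)" 3] cardX by simp
  also have "card B = d choose k" by (simp add: B_def n_subsets)
  also have "(d choose k) * 3 \<le> d ^ k * 3"
    using order.trans[OF _ binomial_fact_pow[of d k], of "d choose k"] by simp
  finally show ?thesis by (simp add: mult.commute)
qed

text \<open>
  The first part is written with \<open>card (support v) + 2 \<le> r\<close> so that it is empty for \<open>r = 1\<close>, which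
  truncated subtraction would not achieve.
\<close>

definition seed_set :: "nat \<Rightarrow> nat \<Rightarrow> nat \<Rightarrow> nat list set" where
  "seed_set n d r = {v \<in> pverts (hamming_graph n d). card (support v) + 2 \<le> r} \<union>
     indicator_vertex d ` zero_sum_blocks d r \<union> indicator_vertex d ` uncompletable_sets d (r - 1)"

text \<open>
  Induction on the sum of the coordinates. Lowering a coordinate of \<open>v\<close> gives a neighbour with a smaller
  sum, and the number of these lower neighbours is exactly the coordinate sum. So \<open>v\<close> becomes active if
  its sum is at least \<open>r\<close>. If the sum is smaller and \<open>v\<close> is not in the seed set, then its support has
  \<open>r - 1\<close> elements and the sum is \<open>r - 1\<close>, so \<open>v\<close> is the indicator vertex of a set \<open>T\<close> with just one
  active neighbour too few. The missing one is the indicator vertex of the block that contains \<open>T\<close>.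
\<close>

lemma percolating_seed_set:
  assumes n: "2 \<le> n" and r: "1 \<le> r" and d: "0 < d"
  shows "percolating (hamming_graph n d) r (seed_set n d r)"
  unfolding percolating_iff_closed[OF pair_graph_hamming_graph]
proof (intro conjI allI impI)
  show "seed_set n d r \<subseteq> pverts (hamming_graph n d)"
    using n by (auto simp: seed_set_def indicator_vertex_in_hamming)
  fix X assume X: "X \<subseteq> pverts (hamming_graph n d)" "seed_set n d r \<subseteq> X"
    "percolation_closed (hamming_graph n d) r X"
  have "v \<in> X" if "v \<in> pverts (hamming_graph n d)" for v
    using that
  proof (induction "\<Sum>i<d. v ! i" arbitrary: v rule: less_induct)
    case less
    note v = less.prems
    have l: "length v = d" "\<And>i. i < d \<Longrightarrow> v ! i < n" using v by (auto simp: pverts_hamming_graph)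
    define P where "P = Sigma {..<d} (\<lambda>i. {..<v ! i})"
    have P: "P \<subseteq> {(i, b). i < d \<and> b < n \<and> b \<noteq> v ! i}" and finP: "finite P"
      using l by (fastforce simp: P_def, simp add: P_def)
    have cardP: "card P = (\<Sum>i<d. v ! i)" by (simp add: P_def)
    have lower: "v[i := b] \<in> X" if "(i, b) \<in> P" for i b
    proof (rule less.hyps)
      have i: "i < d" "b < v ! i" using that by (auto simp: P_def)
      show "(\<Sum>j<d. v[i := b] ! j) < (\<Sum>j<d. v ! j)"
        by (rule sum_strict_mono_ex1) (use i l in \<open>auto simp: nth_list_update\<close>)
      show "v[i := b] \<in> pverts (hamming_graph n d)"
        using v i by (auto simp: pverts_hamming_graph nth_list_update dest: less_trans)
    qed
    have supp: "support v \<subseteq> {..<d}" using l by (auto simp: support_def)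
    have sum_support: "(\<Sum>i<d. v ! i) = (\<Sum>i\<in>support v. v ! i)"
      by (rule sum.mono_neutral_right) (use l in \<open>auto simp: support_def\<close>)
    consider "card (support v) + 2 \<le> r" | "r \<le> (\<Sum>i<d. v ! i)"
      | "r - 1 \<le> card (support v)" "(\<Sum>i<d. v ! i) \<le> r - 1"
      by linarith
    then show ?case
    proof cases
      case 1
      then show ?thesis using v X(2) by (auto simp: seed_set_def)
    next
      case 2
      then show ?thesis
        using percolation_closed_hammingD[OF X(3) v P lower] by (simp add: cardP)
    next
      case 3
      define T where "T = support v"
      have fin: "finite T" and sub: "T \<subseteq> {..<d}" using supp by (simp_all add: T_def)
      have ge1: "1 \<le> v ! i" if "i \<in> T" for i using that by (auto simp: T_def support_def)
      have "card T \<le> (\<Sum>i\<in>T. v ! i)" using sum_mono[of T "\<lambda>_. 1", OF ge1] by simp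
      then have T: "card T = r - 1" "(\<Sum>i\<in>T. v ! i) = card T" and sum_v: "(\<Sum>i<d. v ! i) = r - 1"
        using 3 sum_support by (simp_all add: T_def)
      have v1: "v ! i = 1" if "i \<in> T" for i
      proof (rule ccontr)
        assume "v ! i \<noteq> 1"
        then have "(\<Sum>i\<in>T. 1) < (\<Sum>i\<in>T. v ! i)"
          by (intro sum_strict_mono_ex1 bexI[OF _ that])
            (use fin that ge1 in \<open>auto simp: order.strict_iff_order\<close>)
        then show False using T by simp
      qed
      have nth_v: "v ! i = (if i \<in> T then 1 else 0)" if "i < d" for i
        using that l(1) v1 by (auto simp: T_def support_def)
      have v_eq: "indicator_vertex d T = v"
        using l(1) nth_v by (intro nth_equalityI) simp_all
      show ?thesis
      proof (cases "\<exists>x\<in>T. d dvd x + \<Sum>T")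
        case True
        then have "T \<in> uncompletable_sets d (r - 1)"
          using T(1) sub by (simp add: uncompletable_sets_def)
        then have "indicator_vertex d T \<in> X" using X(2) by (auto simp: seed_set_def)
        then show ?thesis by (simp only: v_eq)
      next
        case False
        obtain x where x: "x < d" "d dvd x + \<Sum>T"
          using ex_completing_residue[OF d] by blast
        have xT: "x \<notin> T" using x(2) False by blast
        have "insert x T \<in> zero_sum_blocks d r"
          using x xT T(1) r sub fin by (simp add: zero_sum_blocks_def)
        then have "indicator_vertex d (insert x T) \<in> X" using X(2) by (auto simp: seed_set_def)
        moreover have "v[x := 1] = indicator_vertex d (insert x T)"
          using l(1) nth_v x(1) by (intro nth_equalityI) (simp_all add: nth_list_update)
        ultimately have upper: "v[x := 1] \<in> X" by (simp only:)
        have vx: "v ! x = 0" using x(1) xT nth_v by simp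
        show ?thesis
        proof (rule percolation_closed_hammingD[OF X(3) v])
          show "insert (x, 1) P \<subseteq> {(i, b). i < d \<and> b < n \<and> b \<noteq> v ! i}"
            using P x(1) n vx by simp
          show "v[i := b] \<in> X" if "(i, b) \<in> insert (x, 1) P" for i b
            using that upper lower by blast
          have "(x, 1) \<notin> P" using vx by (simp add: P_def)
          then show "r \<le> card (insert (x, 1) P)"
            using finP sum_v r by (simp add: cardP)
        qed
      qed
    qed
  qed
  then show "X = pverts (hamming_graph n d)" using X(1) by blast
qed

text \<open>
  Stated after multiplication by \<open>d * r\<close>, so that for \<open>r = 1\<close> no power \<open>d ^ (r - 2)\<close> is needed.
\<close>

lemma card_seed_set:
  assumes "1 \<le> n" "1 \<le> r" "1 \<le> d"
  shows "d * r * card (seed_set n d r) \<le> d * (d choose (r - 1)) + r * (n ^ r + 3) * d ^ (r - 1)"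
proof -
  let ?A = "{v \<in> pverts (hamming_graph n d). card (support v) + 2 \<le> r}"
  let ?B = "indicator_vertex d ` zero_sum_blocks d r"
  let ?C = "indicator_vertex d ` uncompletable_sets d (r - 1)"
  have finB: "finite (zero_sum_blocks d r)" and finC: "finite (uncompletable_sets d (r - 1))"
    by (auto simp: zero_sum_blocks_def uncompletable_sets_def)
  have "r * card ?B \<le> r * card (zero_sum_blocks d r)"
    by (intro mult_le_mono2 card_image_le finB)
  then have B: "r * card ?B \<le> d choose (r - 1)"
    by (rule order.trans[OF _ card_zero_sum_blocks])
  have AC: "d * (card ?A + card ?C) \<le> (n ^ r + 3) * d ^ (r - 1)"
  proof (cases "r = 1")
    case True
    have "uncompletable_sets d 0 = {}"
      by (auto simp: uncompletable_sets_def dest: finite_subset)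
    moreover have "?A = {}" using True by auto
    ultimately show ?thesis using True by simp
  next
    case False
    define k where "k = r - 2"
    then have r: "r = Suc (Suc k)" using False assms(2) by simp
    have "?A = small_support_vertices n d k" by (auto simp: small_support_vertices_def r)
    then have "card ?A \<le> n ^ k * d ^ k"
      using card_small_support_vertices[OF assms(3), of n k] by (simp add: power_mult_distrib mult.commute)
    also have "\<dots> \<le> n ^ r * d ^ k"
      using assms(1) by (intro mult_right_mono power_increasing) (auto simp: r)
    finally have A: "card ?A \<le> n ^ r * d ^ k" .
    have "card ?C \<le> card (uncompletable_sets d (r - 1))" by (rule card_image_le[OF finC])
    also have "\<dots> \<le> 3 * d ^ k" using card_uncompletable_sets[of d k] assms by (simp add: r)
    finally have "card ?A + card ?C \<le> (n ^ r + 3) * d ^ k"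
      using A by (simp add: algebra_simps)
    then have "d * (card ?A + card ?C) \<le> d * ((n ^ r + 3) * d ^ k)" by (rule mult_le_mono2)
    then show ?thesis by (simp add: r algebra_simps)
  qed
  have "card (seed_set n d r) \<le> card ?A + card ?B + card ?C"
    unfolding seed_set_def by (meson card_Un_le add_mono order.trans order.refl)
  then have "d * r * card (seed_set n d r) \<le> d * r * (card ?A + card ?B + card ?C)"
    by (rule mult_le_mono2)
  also have "\<dots> = d * (r * card ?B) + r * (d * (card ?A + card ?C))" by (simp add: algebra_simps)
  also have "\<dots> \<le> d * (d choose (r - 1)) + r * ((n ^ r + 3) * d ^ (r - 1))"
    using B AC by (intro add_mono mult_le_mono2)
  finally show ?thesis by (simp only: mult.assoc)
qed

section \<open>The asymptotic formula\<close>

lemma binomial_ratio_tendsto_1: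
  "(\<lambda>d. real (d choose k) * fact k / real d ^ k) \<longlonglongrightarrow> 1"
proof -
  have "(\<lambda>d. \<Prod>i=0..<k. (real d - real i) / real d) \<longlonglongrightarrow> (\<Prod>i=0..<k. 1)"
    by (intro tendsto_prod) real_asymp
  moreover have "real (d choose k) * fact k / real d ^ k = (\<Prod>i=0..<k. (real d - real i) / real d)" for d
    by (simp add: binomial_gbinomial gbinomial_prod_rev prod_dividef)
  ultimately show ?thesis by simp
qed

theorem theorem1p2:
  fixes n r :: nat
  assumes "n \<ge> 2" and "r \<ge> 1"
  shows "\<exists>\<epsilon> :: nat \<Rightarrow> real. \<epsilon> \<in> o[at_top](\<lambda>_. 1) \<and>
    (\<forall>d\<ge>1. real (min_percolating (hamming_graph n d) r)
            = (1 + \<epsilon> d) * (real d ^ (r - 1) / fact r))"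
proof -
  define k where "k = r - 1"
  define m where "m = (\<lambda>d. min_percolating (hamming_graph n d) r)"
  \<comment> \<open>the ratio \<open>\<rho>\<close> of the two sides lies between \<open>b\<close> and \<open>b\<close> plus an error of order \<open>1 / d\<close>\<close>
  define \<rho> where "\<rho> = (\<lambda>d. real (m d) * fact r / real d ^ k)"
  define b where "b = (\<lambda>d. real (d choose k) * fact k / real d ^ k)"
  define K where "K = real (r * (n ^ r + 3)) * fact k"
  have fact_r: "fact r = real r * fact k"
    using assms(2) by (simp add: k_def fact_reduce)
  have fin: "finite (pverts (hamming_graph n d))" for d
    using pair_graph_hamming_graph[of n d] by (simp add: pair_graph_iff)
  have lower: "b d \<le> \<rho> d" if "r \<le> d" for d
  proof -
    obtain A where "percolating (hamming_graph n d) r A" "card A = m d"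
      using min_percolating_attained(1)[OF fin] unfolding m_def by blast
    then have "d choose k \<le> r * m d"
      using binomial_le_percolating_set[OF assms that] unfolding k_def by metis
    then have "real (d choose k) \<le> real r * real (m d)"
      by (metis of_nat_le_iff of_nat_mult)
    then have "real (d choose k) * fact k / real d ^ k \<le> real r * real (m d) * fact k / real d ^ k"
      by (intro divide_right_mono mult_right_mono) auto
    then show ?thesis unfolding b_def \<rho>_def fact_r by (simp add: mult_ac)
  qed
  have upper: "\<rho> d \<le> b d + K / real d" if "1 \<le> d" for d
  proof -
    have "m d \<le> card (seed_set n d r)"
      unfolding m_def using min_percolating_attained(2)[OF fin] percolating_seed_set assms that by simp
    then have "d * r * m d \<le> d * r * card (seed_set n d r)"
      by (rule mult_le_mono2)
    also have "\<dots> \<le> d * (d choose k) + r * (n ^ r + 3) * d ^ k"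
      unfolding k_def by (rule card_seed_set[OF _ assms(2) that]) (use assms(1) in simp)
    finally have "d * r * m d \<le> d * (d choose k) + r * (n ^ r + 3) * d ^ k" .
    then have "real (d * r * m d) \<le> real (d * (d choose k) + r * (n ^ r + 3) * d ^ k)"
      by (simp only: of_nat_le_iff)
    then have "real (d * r * m d) * fact k / (real d * real d ^ k)
        \<le> real (d * (d choose k) + r * (n ^ r + 3) * d ^ k) * fact k / (real d * real d ^ k)"
      by (intro divide_right_mono mult_right_mono) auto
    moreover have "real (d * r * m d) * fact k / (real d * real d ^ k) = \<rho> d"
      using that by (simp add: \<rho>_def fact_r field_simps)
    moreover have "real (d * (d choose k) + r * (n ^ r + 3) * d ^ k) * fact k / (real d * real d ^ k)
        = b d + K / real d"
      using that by (simp add: b_def K_def field_simps)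
    ultimately show ?thesis by simp
  qed
  have b1: "b \<longlonglongrightarrow> 1" unfolding b_def by (rule binomial_ratio_tendsto_1)
  have "(\<lambda>d. b d + K / real d) \<longlonglongrightarrow> 1 + 0"
    by (intro tendsto_add b1 lim_const_over_n)
  then have upper1: "(\<lambda>d. b d + K / real d) \<longlonglongrightarrow> 1"
    by simp
  have "\<rho> \<longlonglongrightarrow> 1"
  proof (rule tendsto_sandwich[OF _ _ b1 upper1])
    show "\<forall>\<^sub>F d in sequentially. b d \<le> \<rho> d"
      using lower by (rule eventually_sequentiallyI)
    show "\<forall>\<^sub>F d in sequentially. \<rho> d \<le> b d + K / real d"
      using upper by (rule eventually_sequentiallyI)
  qed
  then have "(\<lambda>d. \<rho> d - 1) \<in> o[at_top](\<lambda>_. 1)"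
    by (intro smalloI_tendsto) (auto simp: LIM_zero_iff)
  moreover have "real (min_percolating (hamming_graph n d) r)
            = (1 + (\<rho> d - 1)) * (real d ^ (r - 1) / fact r)" if "1 \<le> d" for d
    using that by (simp add: \<rho>_def m_def k_def)
  ultimately show ?thesis by blast
qed

end
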